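(* Let $\alpha,\beta>0$, $n\ge1$, and let $S_n(z;\alpha,\beta)=z\frac{d}{dz}\ln\Delta_n(z;\alpha,\beta)$ with $\Delta_n(z;\alpha,\beta)=\mathcal{W}_n\big(M(\alpha,\beta,z)\big)$. Then $S=S_n$ satisfies $$\Big(z\frac{d^2S}{dz^2}\Big)^2=\Big[(z+n+\beta-1)\frac{dS}{dz}-S-\tfrac12 n(n-1+2\alpha)\Big]^2-4\frac{dS}{dz}\Big(\frac{dS}{dz}-n-\alpha+\beta\Big)\Big[z\frac{dS}{dz}-S+\tfrac12n(n-1)\Big].$$
   Context: $M(\alpha,\beta,z)$ is the Kummer function ${}_1F_1(\alpha;\beta;z)$; $\delta_z= z\,\frac{d}{dz}$; for smooth $\psi$, $\mathcal{W}_n(\psi)=\det[\delta_z^{\,j+k}\psi]_{j,k=0}^{n-1}$. (This $\Delta_n$ is the Hankel determinant of moments of the weight $(\alpha)_kz^k/((\beta)_k k!)$ on $\mathbb{N}$.) *)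

theory Defs
  imports "HOL-Analysis.Analysis" "Jordan_Normal_Form.Determinant"
begin

definition kummerM :: "complex \<Rightarrow> complex \<Rightarrow> complex \<Rightarrow> complex" where
  "kummerM a b z = (\<Sum>k. pochhammer a k * z ^ k / (pochhammer b k * fact k))"

definition euler_op :: "(complex \<Rightarrow> complex) \<Rightarrow> (complex \<Rightarrow> complex)" where
  "euler_op f = (\<lambda>z. z * deriv f z)"

definition hankelW :: "nat \<Rightarrow> (complex \<Rightarrow> complex) \<Rightarrow> complex \<Rightarrow> complex" where
  "hankelW n \<psi> z = det (mat n n (\<lambda>(j, k). (euler_op ^^ (j + k)) \<psi> z))"

definition DeltaK :: "nat \<Rightarrow> real \<Rightarrow> real \<Rightarrow> complex \<Rightarrow> complex" where
  "DeltaK n a b = hankelW n (kummerM (of_real a) (of_real b))"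

definition SK :: "nat \<Rightarrow> real \<Rightarrow> real \<Rightarrow> complex \<Rightarrow> complex" where
  "SK n a b z = z * deriv (DeltaK n a b) z / DeltaK n a b z"

end

(*
  Let P_n be the monic orthogonal polynomials of the moment functional L of the weight w, with
  x P_n = P_{n+1} + b_n P_n + a_n P_{n-1}. The moments satisfy m_{j+1} = z dm_j/dz, which gives the
  Toda flow z dP_n/dz = - a_n P_{n-1}; hence S_n = b_0 + ... + b_{n-1}, z S_n' = a_n and
  z^2 S_n'' = a_n (b_n - b_{n-1} - 1).
  The weight satisfies (\<beta> + k) (k + 1) w(k + 1) = z (\<alpha> + k) w(k), so
  L[x (x + \<beta> - 1) f(x)] = z L[(x + \<alpha>) f(x + 1)] for every polynomial f. Taking
  f(x) = P_n(x) P_n(x - 1) and f(x) = P_n(x) P_{n-1}(x - 1) yields two difference equations,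
  and these imply by induction on n that the quantity
  a_n (b_n - n - z) (b_{n-1} - n + 1 - z) - (a_n - (n + \<alpha> - \<beta>) z) (a_n - S_n + n (n - 1) / 2)
  vanishes. Eliminating b_n and b_{n-1} gives the sigma equation wherever z and all the
  determinants involved are nonzero, and the identity theorem removes this restriction:
  at z = 1 the weight is positive, so the determinants do not vanish there.
*)

theory Submission
  imports Defs "HOL-Complex_Analysis.Complex_Analysis"
begin

hide_const (open) Module.smult

section \<open>Monic orthogonal polynomials of a moment sequence\<close>

definition mfun :: "(nat \<Rightarrow> 'a::field_char_0) \<Rightarrow> 'a poly \<Rightarrow> 'a" where
  "mfun \<mu> p = (\<Sum>i\<le>degree p. coeff p i * \<mu> i)"

lemma mfun_eq: "degree p \<le> N \<Longrightarrow> mfun \<mu> p = (\<Sum>i\<le>N. coeff p i * \<mu> i)"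
  unfolding mfun_def by (rule sum.mono_neutral_left) (auto intro!: coeff_eq_0)

lemma mfun_0 [simp]: "mfun \<mu> 0 = 0"
  by (simp add: mfun_def)

lemma mfun_add: "mfun \<mu> (p + q) = mfun \<mu> p + mfun \<mu> q"
proof -
  have "degree (p + q) \<le> max (degree p) (degree q)"
    by (rule degree_add_le_max)
  then show ?thesis
    by (simp add: mfun_eq[of _ "max (degree p) (degree q)"] algebra_simps sum.distrib)
qed

lemma mfun_smult: "mfun \<mu> (smult c p) = c * mfun \<mu> p"
  by (simp add: mfun_eq[of _ "degree p"] sum_distrib_left mult.assoc)

lemma mfun_minus: "mfun \<mu> (- p) = - mfun \<mu> p"
  using mfun_smult[of \<mu> "-1" p] by simp

lemma mfun_diff: "mfun \<mu> (p - q) = mfun \<mu> p - mfun \<mu> q"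
  using mfun_add[of \<mu> p "- q"] by (simp add: mfun_minus)

lemma mfun_sum: "mfun \<mu> (\<Sum>i\<in>A. f i) = (\<Sum>i\<in>A. mfun \<mu> (f i))"
  by (induction A rule: infinite_finite_induct) (auto simp: mfun_add)

lemmas mfun_lin = mfun_add mfun_diff mfun_smult

lemma mfun_monom_mult:
  assumes "degree p \<le> N"
  shows "mfun \<mu> (monom 1 j * p) = (\<Sum>i\<le>N. coeff p i * \<mu> (i + j))"
proof -
  have "monom 1 j * p = (\<Sum>i\<le>N. monom (coeff p i) (i + j))"
    by (subst (1) poly_as_sum_of_monoms'[OF assms, symmetric])
       (simp add: sum_distrib_left mult_monom add.commute)
  moreover have "mfun \<mu> (monom c k) = c * \<mu> k" for c k
    by (subst mfun_eq[of _ k]) (auto simp: degree_monom_le if_distrib[of "\<lambda>x. x * _"] cong: if_cong)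
  ultimately show ?thesis
    by (simp add: mfun_sum)
qed

lemma mfun_mult:
  assumes "degree q \<le> N"
  shows "mfun \<mu> (q * p) = (\<Sum>i\<le>N. coeff q i * mfun \<mu> (monom 1 i * p))"
proof -
  have "q * p = (\<Sum>i\<le>N. smult (coeff q i) (monom 1 i * p))"
    by (subst (1) poly_as_sum_of_monoms'[OF assms, symmetric])
       (simp add: sum_distrib_right smult_monom flip: mult_smult_left)
  then show ?thesis
    by (simp add: mfun_sum mfun_smult)
qed

text \<open>P_n is built from the recurrence, so it is monic of degree n even where a denominator is
  zero, and orthogonality becomes a theorem about nonzero norms. The choice of \<open>a\<close>
  makes P_{n+2} orthogonal to x^n, the choice of \<open>b\<close> makes it orthogonal to
  x^(n+1).\<close>

fun mop :: "(nat \<Rightarrow> 'a::field_char_0) \<Rightarrow> nat \<Rightarrow> 'a poly" where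
  "mop \<mu> 0 = 1"
| "mop \<mu> (Suc 0) = [:- \<mu> 1 / \<mu> 0, 1:]"
| "mop \<mu> (Suc (Suc n)) =
     (let p = mop \<mu> (Suc n); q = mop \<mu> n;
          h = mfun \<mu> (monom 1 (Suc n) * p);
          a = h / mfun \<mu> (monom 1 n * q);
          b = (mfun \<mu> (monom 1 (Suc (Suc n)) * p) - a * mfun \<mu> (monom 1 (Suc n) * q)) / h
      in [:- b, 1:] * p - smult a q)"

text \<open>The squared norm h_n = L[P_n^2] in the orthogonal case; pairing with x^n lets it enter
  the recurrence before orthogonality is known.\<close>

definition nrm :: "(nat \<Rightarrow> 'a::field_char_0) \<Rightarrow> nat \<Rightarrow> 'a" where
  "nrm \<mu> n = mfun \<mu> (monom 1 n * mop \<mu> n)"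

definition rca :: "(nat \<Rightarrow> 'a::field_char_0) \<Rightarrow> nat \<Rightarrow> 'a" where
  "rca \<mu> n = (if n = 0 then 0 else nrm \<mu> n / nrm \<mu> (n - 1))"

definition rcb :: "(nat \<Rightarrow> 'a::field_char_0) \<Rightarrow> nat \<Rightarrow> 'a" where
  "rcb \<mu> n = (mfun \<mu> (monom 1 (Suc n) * mop \<mu> n)
     - rca \<mu> n * mfun \<mu> (monom 1 n * mop \<mu> (n - 1))) / nrm \<mu> n"

definition rcs :: "(nat \<Rightarrow> 'a::field_char_0) \<Rightarrow> nat \<Rightarrow> 'a" where
  "rcs \<mu> n = (\<Sum>k<n. rcb \<mu> k)"

lemma rca_0 [simp]: "rca \<mu> 0 = 0"
  by (simp add: rca_def)

lemma rcs_0 [simp]: "rcs \<mu> 0 = 0"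
  by (simp add: rcs_def)

lemma rcs_Suc: "rcs \<mu> (Suc n) = rcs \<mu> n + rcb \<mu> n"
  by (simp add: rcs_def)

text \<open>For n = 0 the junk index n - 1 = 0 is harmless because rca vanishes at 0.\<close>

lemma mop_Suc: "mop \<mu> (Suc n) = [:- rcb \<mu> n, 1:] * mop \<mu> n - smult (rca \<mu> n) (mop \<mu> (n - 1))"
proof (cases n)
  case 0
  have "mfun \<mu> (monom 1 j * 1) = \<mu> j" for j
    using mfun_monom_mult[of 1 0 \<mu> j] by simp
  from this[of 0] this[of 1] 0 show ?thesis
    by (simp add: rcb_def nrm_def)
next
  case (Suc m)
  then show ?thesis
    by (simp add: Let_def rca_def rcb_def nrm_def)
qed

lemmas [simp del] = mop.simps(2,3)

lemma degree_mop_le: "degree (mop \<mu> n) \<le> n"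
  and coeff_mop_self [simp]: "coeff (mop \<mu> n) n = 1"
proof (induction n rule: less_induct)
  case (less n)
  {
    case 1
    show ?case
    proof (cases n)
      case (Suc m)
      have "degree (mop \<mu> (m - 1)) \<le> m" "degree (mop \<mu> m) \<le> m"
        using less(1)[of "m - 1"] less(1)[of m] Suc by linarith+
      then show ?thesis
        unfolding Suc mop_Suc
        by (intro degree_diff_le order.trans[OF degree_mult_le] order.trans[OF degree_smult_le])
           (auto intro: order.trans)
    qed auto
  next
    case 2
    show ?case
    proof (cases n)
      case (Suc m)
      have "degree (mop \<mu> (m - 1)) < Suc m" "degree (mop \<mu> m) < Suc m"
        using less(1)[of "m - 1"] less(1)[of m] Suc by linarith+
      then have "coeff (mop \<mu> (m - 1)) (Suc m) = 0" "coeff (mop \<mu> m) (Suc m) = 0"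
        by (auto intro!: coeff_eq_0)
      then show ?thesis
        using less(2)[of m] unfolding Suc mop_Suc by simp
    qed auto
  }
qed

lemma coeff_mop_above [simp]: "n < k \<Longrightarrow> coeff (mop \<mu> n) k = 0"
  using degree_mop_le[of \<mu> n] by (intro coeff_eq_0) auto

lemma degree_mop [simp]: "degree (mop \<mu> n) = n"
  by (metis coeff_mop_self degree_mop_le le_antisym le_degree zero_neq_one)

text \<open>Each step of the recurrence lowers the subleading coefficient by b_n. This ties
  \<open>rcs\<close>, which turns out to be S_n, to the polynomials.\<close>

lemma coeff_mop_sub: "coeff (mop \<mu> (Suc n)) n = - rcs \<mu> (Suc n)"
proof (induction n)
  case 0
  show ?case by (simp add: mop_Suc rcs_def)
next
  case (Suc n)
  then show ?case
    by (subst mop_Suc) (simp add: rcs_Suc)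
qed

lemma mop_xmult: "pCons 0 (mop \<mu> n) =
    mop \<mu> (Suc n) + smult (rcb \<mu> n) (mop \<mu> n) + smult (rca \<mu> n) (mop \<mu> (n - 1))"
  by (simp add: mop_Suc)

lemma monom_Suc_mult: "monom 1 (Suc j) * p = monom 1 j * pCons 0 (p :: 'a::field_char_0 poly)"
  by (simp add: monom_Suc)

text \<open>Pairing the recurrence for P_{m+1} with x^j leaves three terms. For j = m they cancel by
  the definition of b_m, for j = m - 1 by that of a_m, and for smaller j each vanishes by
  induction.\<close>

lemma mop_orth_monom:
  assumes "\<And>k. k < n \<Longrightarrow> nrm \<mu> k \<noteq> 0" "m \<le> n" "j < m"
  shows "mfun \<mu> (monom 1 j * mop \<mu> m) = 0"
  using assms(2,3)
proof (induction m arbitrary: j rule: less_induct)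
  case (less m')
  then obtain m where m: "m' = Suc m"
    by (cases m') auto
  have nz: "nrm \<mu> m \<noteq> 0" "nrm \<mu> (m - 1) \<noteq> 0"
    using assms(1) less.prems m by auto
  have eq: "mfun \<mu> (monom 1 j * mop \<mu> m') = mfun \<mu> (monom 1 (Suc j) * mop \<mu> m)
      - rcb \<mu> m * mfun \<mu> (monom 1 j * mop \<mu> m) - rca \<mu> m * mfun \<mu> (monom 1 j * mop \<mu> (m - 1))"
    unfolding m monom_Suc_mult mop_xmult by (simp add: algebra_simps mfun_lin)
  consider "j = m" | "j < m" "Suc j = m" | "Suc j < m"
    using less.prems m by linarith
  then show ?case
  proof cases
    case 1
    with nz show ?thesis
      unfolding eq by (simp add: rcb_def nrm_def)
  next
    case 2
    have "mfun \<mu> (monom 1 j * mop \<mu> m) = 0"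
      using less.prems 2 m by (intro less.IH) auto
    then show ?thesis
      unfolding eq using 2 nz by (auto simp: rca_def nrm_def)
  next
    case 3
    have "mfun \<mu> (monom 1 j * mop \<mu> m) = 0" "mfun \<mu> (monom 1 (Suc j) * mop \<mu> m) = 0"
      "mfun \<mu> (monom 1 j * mop \<mu> (m - 1)) = 0"
      using less.prems 3 m by (auto intro!: less.IH)
    then show ?thesis
      unfolding eq by simp
  qed
qed

text \<open>Orthogonality removes all powers below x^n. Only the norms before index n have to be
  nonzero, so \<open>nrm \<mu> n\<close> itself may be zero; the positivity argument at z = 1 relies
  on this.\<close>

lemma mop_pair:
  assumes "\<And>k. k < n \<Longrightarrow> nrm \<mu> k \<noteq> 0" "degree q \<le> n"
  shows "mfun \<mu> (q * mop \<mu> n) = coeff q n * nrm \<mu> n"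
proof -
  have "mfun \<mu> (q * mop \<mu> n) = (\<Sum>i\<le>n. coeff q i * mfun \<mu> (monom 1 i * mop \<mu> n))"
    by (rule mfun_mult) fact
  also have "\<dots> = (\<Sum>i\<in>{n}. coeff q i * mfun \<mu> (monom 1 i * mop \<mu> n))"
    by (rule sum.mono_neutral_right) (auto intro!: mop_orth_monom[where n = n] assms)
  finally show ?thesis
    by (simp add: nrm_def)
qed

text \<open>Subtracting a multiple of P_{n+1}, which is orthogonal to P_n, lowers the degree of
  \<open>q\<close> to n; the subleading coefficient of P_{n+1} brings in \<open>rcs\<close>.\<close>

lemma mop_pair_Suc:
  assumes "\<And>k. k \<le> n \<Longrightarrow> nrm \<mu> k \<noteq> 0" "degree q \<le> Suc n"
  shows "mfun \<mu> (q * mop \<mu> n) = (coeff q n + coeff q (Suc n) * rcs \<mu> (Suc n)) * nrm \<mu> n"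
proof -
  define r where "r = q - smult (coeff q (Suc n)) (mop \<mu> (Suc n))"
  have "coeff r (Suc n) = 0" "degree r \<le> Suc n"
    unfolding r_def by (auto intro!: degree_diff_le assms order.trans[OF degree_smult_le])
  then have r: "degree r \<le> n"
    by (metis le_SucE leading_coeff_0_iff degree_0 le0)
  have "mfun \<mu> (mop \<mu> (Suc n) * mop \<mu> n) = 0"
    using mop_pair[of "Suc n" \<mu> "mop \<mu> n"] assms(1) by (simp add: mult.commute)
  moreover have "mfun \<mu> (r * mop \<mu> n) = coeff r n * nrm \<mu> n"
    using assms(1) r by (intro mop_pair) auto
  ultimately show ?thesis
    by (simp add: r_def algebra_simps mfun_lin coeff_mop_sub)
qed

lemma rca_Suc: "nrm \<mu> n \<noteq> 0 \<Longrightarrow> nrm \<mu> (Suc n) = rca \<mu> (Suc n) * nrm \<mu> n"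
  by (simp add: rca_def)

section \<open>Structure relations for a functional with a Pearson equation\<close>

lemma pcompose_monom_linear: "pcompose (monom a i) [:c, 1:] = smult a ([:c, 1:] ^ i)"
  for a :: "'a::field_char_0"
proof (induction i)
  case 0
  show ?case by (simp add: monom_0)
next
  case (Suc i)
  then show ?case by (simp add: monom_Suc pcompose_pCons mult.commute)
qed

lemma coeff_pcompose_shift:
  fixes p :: "'a::field_char_0 poly"
  assumes "degree p \<le> N"
  shows "coeff (pcompose p [:c, 1:]) k = (\<Sum>i\<le>N. coeff p i * (of_nat (i choose k) * c ^ (i - k)))"
proof -
  have "pcompose p [:c, 1:] = (\<Sum>i\<le>N. smult (coeff p i) ([:c, 1:] ^ i))"
    by (subst (1) poly_as_sum_of_monoms'[OF assms, symmetric])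
       (simp add: pcompose_sum pcompose_monom_linear)
  moreover have "coeff ([:c, 1:] ^ i) k = of_nat (i choose k) * c ^ (i - k)" for i
  proof (cases "k \<le> i")
    case False
    moreover have "degree ([:c, 1:] ^ i) = i"
      by (rule degree_linear_power)
    ultimately show ?thesis
      by (simp add: coeff_eq_0 binomial_eq_0)
  qed (simp add: coeff_linear_poly_power)
  ultimately show ?thesis
    by (simp add: coeff_sum)
qed

text \<open>The remainder has degree at most n - 2; multiplying it by the square of the variable
  avoids truncated subtraction and forces it to vanish for n < 2.\<close>

lemma mop_shift_expansion:
  fixes c :: "'a::field_char_0"
  obtains r where
    "pcompose (mop \<mu> n) [:c, 1:] = mop \<mu> n + smult (of_nat n * c) (mop \<mu> (n - 1)) + r"
    "degree (pCons 0 (pCons 0 r)) \<le> n"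
    "coeff (pCons 0 (pCons 0 r)) n = of_nat n * (of_nat n - 1) / 2 * c\<^sup>2
       - (of_nat n - 1) * c * rcs \<mu> n + of_nat n * c * rcs \<mu> (n - 1)"
proof -
  define r where "r = pcompose (mop \<mu> n) [:c, 1:] - mop \<mu> n - smult (of_nat n * c) (mop \<mu> (n - 1))"
  have cf: "coeff (pcompose (mop \<mu> n) [:c, 1:]) k
      = (\<Sum>i\<le>n. coeff (mop \<mu> n) i * (of_nat (i choose k) * c ^ (i - k)))" for k
    by (rule coeff_pcompose_shift) simp
  have "degree (pCons 0 (pCons 0 r)) \<le> n \<and> coeff (pCons 0 (pCons 0 r)) n = of_nat n * (of_nat n - 1) / 2 * c\<^sup>2
       - (of_nat n - 1) * c * rcs \<mu> n + of_nat n * c * rcs \<mu> (n - 1)"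
  proof -
    consider "n = 0" | "n = 1" | m where "n = Suc (Suc m)"
      by (metis One_nat_def not0_implies_Suc)
    then show ?thesis
    proof cases
      case 1
      then show ?thesis by (simp add: r_def pcompose_1)
    next
      case 2
      then have "r = 0" by (simp add: r_def mop_Suc pcompose_pCons)
      with 2 show ?thesis by simp
    next
      case 3
      have s: "(\<Sum>i\<le>n. coeff (mop \<mu> n) i * (of_nat (i choose k) * c ^ (i - k)))
          = (\<Sum>i\<in>{k..n}. coeff (mop \<mu> n) i * (of_nat (i choose k) * c ^ (i - k)))" for k
        by (rule sum.mono_neutral_right) auto
      have rc: "coeff r k = (\<Sum>i\<in>{k..n}. coeff (mop \<mu> n) i * (of_nat (i choose k) * c ^ (i - k)))
          - coeff (mop \<mu> n) k - of_nat n * c * coeff (mop \<mu> (n - 1)) k" for k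
        by (simp add: r_def cf s)
      \<comment> \<open>The leading terms cancel at degree n, and the multiple of P_{n-1} removes
        the term n c at degree n - 1.\<close>
      have *: "coeff r k = 0" if "k > m" for k
      proof (cases "k > Suc m")
        case True
        then consider "k = n" | "k > n" using 3 by linarith
        then show ?thesis using 3
          by cases (simp_all add: rc)
      next
        case False
        with that have "k = Suc m" by simp
        moreover have "{Suc m..n} = {Suc m, n}" using 3 by auto
        ultimately show ?thesis using 3
          by (simp add: rc coeff_mop_sub)
      qed
      \<comment> \<open>The unknown coefficient of x^m in P_n occurs with both signs and drops out,
        so only coefficients given by \<open>rcs\<close> remain.\<close>
      have "{m..n} = {m, Suc m, n}" using 3 by auto
      then have "coeff r m = of_nat (n choose m) * c\<^sup>2 - of_nat (Suc m) * c * rcs \<mu> n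
         + of_nat n * c * rcs \<mu> (Suc m)"
        using 3 coeff_mop_sub[of \<mu> m] coeff_mop_sub[of \<mu> "Suc m"]
        by (simp add: rc algebra_simps power2_eq_square)
      moreover have "of_nat (n choose m) = (of_nat n * (of_nat n - 1) / 2 :: 'a)"
      proof -
        have "n choose m = n choose 2"
          using binomial_symmetric[of m n] 3 by (simp add: numeral_2_eq_2)
        then have "2 * (n choose m) = n * Suc m"
          using 3 by (simp add: choose_two)
        then have "2 * of_nat (n choose m) = (of_nat n * of_nat (Suc m) :: 'a)"
          by (metis of_nat_mult of_nat_numeral)
        then show ?thesis
          using 3 by (simp add: field_simps)
      qed
      ultimately have "coeff r m = of_nat n * (of_nat n - 1) / 2 * c\<^sup>2
        - (of_nat n - 1) * c * rcs \<mu> n + of_nat n * c * rcs \<mu> (n - 1)"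
        using 3 by simp
      moreover have "degree (pCons 0 (pCons 0 r)) \<le> n"
        using * 3 by (intro degree_le) (auto simp: coeff_pCons split: nat.split)
      ultimately show ?thesis using 3 by simp
    qed
  qed
  then show ?thesis
    using that[of r] by (simp add: r_def)
qed


text \<open>A shift by c keeps P_n monic and adds n c to the subleading coefficient. The factor
  \<open>pCons 0\<close> moves index n - 1 to n, which also covers n = 0.\<close>

lemma coeff_mop_shift:
  "coeff (pcompose (mop \<mu> n) [:c, 1:]) n = 1"
  "n < k \<Longrightarrow> coeff (pcompose (mop \<mu> n) [:c, 1:]) k = 0"
  "coeff (pCons 0 (pcompose (mop \<mu> n) [:c, 1:])) n = of_nat n * c - rcs \<mu> n"
proof -
  obtain r where r: "pcompose (mop \<mu> n) [:c, 1:] = mop \<mu> n + smult (of_nat n * c) (mop \<mu> (n - 1)) + r"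
    "degree (pCons 0 (pCons 0 r)) \<le> n"
    by (rule mop_shift_expansion)
  have r0: "coeff (pCons 0 r) k = 0" if "k \<ge> n" for k
    using coeff_eq_0[of "pCons 0 (pCons 0 r)" "Suc k"] r(2) that by simp
  have r1: "coeff r k = 0" if "k \<ge> n" for k
    using r0[of "Suc k"] that by simp
  show "coeff (pcompose (mop \<mu> n) [:c, 1:]) n = 1"
    unfolding r(1) coeff_add coeff_smult r1[OF order.refl] by (cases n) simp_all
  show "coeff (pcompose (mop \<mu> n) [:c, 1:]) k = 0" if "n < k"
    unfolding r(1) coeff_add coeff_smult using that by (simp add: r1)
  show "coeff (pCons 0 (pcompose (mop \<mu> n) [:c, 1:])) n = of_nat n * c - rcs \<mu> n"
    using r0[of n] unfolding r(1) by (cases n) (simp_all add: coeff_mop_sub)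
qed

lemma degree_mop_shift: "degree (pcompose (mop \<mu> n) [:c, 1:]) \<le> n"
  by (intro degree_le) (auto simp: coeff_mop_shift)

section \<open>Products with the factors of the Pearson equation, and L[x P_n^2] and
  L[x^2 P_n^2]\<close>

lemma quad_mult: "[:0, c, 1:] * p = pCons 0 (pCons 0 p) + smult c (pCons 0 (p :: 'a::field_char_0 poly))"
  by simp

lemma lin_mult: "[:c, 1:] * p = pCons 0 p + smult c (p :: 'a::field_char_0 poly)"
  by simp

lemma degree_quad_mult: "degree p \<le> n \<Longrightarrow> degree ([:0, c, 1:] * (p :: 'a::field_char_0 poly)) \<le> Suc (Suc n)"
  by (rule order.trans[OF degree_mult_le]) simp

lemma degree_lin_mult: "degree p \<le> n \<Longrightarrow> degree ([:c, 1:] * (p :: 'a::field_char_0 poly)) \<le> Suc n"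
  by (rule order.trans[OF degree_mult_le]) simp

lemma mfun_x_mop:
  assumes "\<And>k. k \<le> n \<Longrightarrow> nrm \<mu> k \<noteq> 0"
  shows "mfun \<mu> (pCons 0 (mop \<mu> n) * mop \<mu> n) = rcb \<mu> n * nrm \<mu> n"
  using mop_pair_Suc[of n \<mu> "pCons 0 (mop \<mu> n)"] assms
  by (cases n) (simp_all add: rcs_Suc coeff_mop_sub)

text \<open>One factor x goes to the second P_n and is absorbed by the recurrence; pairing the three
  terms with x P_n gives h_{n+1} = a_{n+1} h_n, b_n^2 h_n and a_n h_n.\<close>

lemma mfun_xx_mop:
  assumes "\<And>k. k \<le> n \<Longrightarrow> nrm \<mu> k \<noteq> 0"
  shows "mfun \<mu> (pCons 0 (pCons 0 (mop \<mu> n)) * mop \<mu> n)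
     = (rca \<mu> (Suc n) + (rcb \<mu> n)\<^sup>2 + rca \<mu> n) * nrm \<mu> n"
proof -
  have 1: "pCons 0 (pCons 0 (mop \<mu> n)) * mop \<mu> n = pCons 0 (mop \<mu> n) * pCons 0 (mop \<mu> n)"
    by simp
  have 2: "mfun \<mu> (pCons 0 (mop \<mu> n) * mop \<mu> (Suc n)) = nrm \<mu> (Suc n)"
    using mop_pair[of "Suc n" \<mu> "pCons 0 (mop \<mu> n)"] assms by simp
  have 3: "rca \<mu> n * mfun \<mu> (pCons 0 (mop \<mu> n) * mop \<mu> (n - 1)) = rca \<mu> n * nrm \<mu> n"
  proof (cases n)
    case (Suc m)
    have "mfun \<mu> (pCons 0 (mop \<mu> m) * mop \<mu> n) = nrm \<mu> n"
      using mop_pair[of n \<mu> "pCons 0 (mop \<mu> m)"] assms Suc by simp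
    then show ?thesis
      using Suc by (simp add: mult.commute)
  qed simp
  show ?thesis
    unfolding 1 using 2 3 mfun_x_mop[OF assms, of n]
    by (subst (2) mop_xmult)
       (simp add: rca_Suc assms algebra_simps mfun_lin power2_eq_square del: mult_pCons_left mult_pCons_right)
qed

text \<open>The index shift for a weight with (\<beta> + k) (k + 1) w(k + 1) = z (\<alpha> + k)
  w(k), stated for the functional alone so that its consequences are pure algebra.\<close>

locale pearson =
  fixes \<mu> :: "nat \<Rightarrow> 'a::field_char_0" and \<alpha> \<beta> z :: 'a
  assumes pearson: "mfun \<mu> ([:0, \<beta> - 1, 1:] * f) = z * mfun \<mu> ([:\<alpha>, 1:] * pcompose f [:1, 1:])"
begin

text \<open>Take f(x) = p(x) q(x - 1): a backward shift of \<open>q\<close> on the left is traded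
  for a forward shift of \<open>p\<close> on the right.\<close>

lemma pearson_shifted:
  "mfun \<mu> ([:0, \<beta> - 1, 1:] * pcompose q [:-1, 1:] * p)
     = z * mfun \<mu> ([:\<alpha>, 1:] * pcompose p [:1, 1:] * q)"
proof -
  have "pcompose (pcompose q [:-1, 1:]) [:1, 1:] = q"
    by (simp flip: pcompose_assoc add: pcompose_pCons)
  then show ?thesis
    using pearson[of "pcompose q [:-1, 1:] * p"] by (simp add: pcompose_mult mult_ac)
qed

text \<open>Take p = q = P_n. On the left P_n(x - 1) is P_n - n P_{n-1} plus a remainder of degree
  at most n - 2; on the right the polynomial paired with P_n has degree n + 1, so its two top
  coefficients suffice. Division by h_n gives the claim.\<close>

lemma structure_relation_diag:
  assumes nz: "\<And>k. k \<le> n \<Longrightarrow> nrm \<mu> k \<noteq> 0"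
  shows "rca \<mu> (Suc n) + rca \<mu> n + (rcb \<mu> n)\<^sup>2 + (\<beta> - 1 - of_nat n) * rcb \<mu> n - rcs \<mu> n
      - of_nat n * (\<beta> - 1) + of_nat n * (of_nat n - 1) / 2 = z * (rcb \<mu> n + \<alpha> + of_nat n)"
proof -
  obtain r where r: "pcompose (mop \<mu> n) [:-1, 1:] = mop \<mu> n + smult (of_nat n * (-1)) (mop \<mu> (n - 1)) + r"
    "degree (pCons 0 (pCons 0 r)) \<le> n"
    "coeff (pCons 0 (pCons 0 r)) n = of_nat n * (of_nat n - 1) / 2 * (-1)\<^sup>2
       - (of_nat n - 1) * (-1) * rcs \<mu> n + of_nat n * (-1) * rcs \<mu> (n - 1)"
    by (rule mop_shift_expansion)
  let ?q = "[:0, \<beta> - 1, 1:]"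
  have t1: "mfun \<mu> (?q * mop \<mu> n * mop \<mu> n)
      = (rca \<mu> (Suc n) + (rcb \<mu> n)\<^sup>2 + rca \<mu> n + (\<beta> - 1) * rcb \<mu> n) * nrm \<mu> n"
    unfolding quad_mult distrib_right mult_smult_left mfun_lin
    using mfun_xx_mop[of n \<mu>] mfun_x_mop[of n \<mu>] nz
    by (simp add: algebra_simps del: mult_pCons_left mult_pCons_right)
  \<comment> \<open>The factor n stays in front so that the truncated index n - 1 does no harm at n
    = 0.\<close>
  have t2: "of_nat n * mfun \<mu> (?q * mop \<mu> (n - 1) * mop \<mu> n)
      = of_nat n * (\<beta> - 1 - rcs \<mu> (n - 1) + rcs \<mu> (Suc n)) * nrm \<mu> n"
  proof (cases n)
    case (Suc m)
    have "coeff (?q * mop \<mu> m) n = \<beta> - 1 - rcs \<mu> m" "coeff (?q * mop \<mu> m) (Suc n) = 1"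
      unfolding quad_mult using Suc by (cases m; simp add: coeff_mop_sub)+
    then have "mfun \<mu> (?q * mop \<mu> m * mop \<mu> n) = (\<beta> - 1 - rcs \<mu> m + rcs \<mu> (Suc n)) * nrm \<mu> n"
      using mop_pair_Suc[OF nz, of n "?q * mop \<mu> m"] degree_quad_mult[of "mop \<mu> m" m "\<beta> - 1"] Suc
      by simp
    then show ?thesis
      using Suc by simp
  qed simp
  \<comment> \<open>Multiplication by the quadratic raises the degree of \<open>r\<close> to at most
    n, so only the coefficient fixed by the expansion survives the pairing with P_n.\<close>
  have r0: "coeff (pCons 0 r) k = 0" if "k \<ge> n" for k
    using coeff_eq_0[of "pCons 0 (pCons 0 r)" "Suc k"] r(2) that by simp
  have "degree (?q * r) \<le> n"
    unfolding quad_mult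
    by (intro degree_add_le r(2) order.trans[OF degree_smult_le] degree_le allI impI r0) auto
  moreover have "coeff (?q * r) n = coeff (pCons 0 (pCons 0 r)) n"
    unfolding quad_mult coeff_add coeff_smult using r0[of n] by simp
  ultimately have t3: "mfun \<mu> (?q * r * mop \<mu> n) = coeff (pCons 0 (pCons 0 r)) n * nrm \<mu> n"
    using mop_pair[of n \<mu> "?q * r"] nz by simp
  have L: "mfun \<mu> (?q * pcompose (mop \<mu> n) [:-1, 1:] * mop \<mu> n)
     = mfun \<mu> (?q * mop \<mu> n * mop \<mu> n) - of_nat n * mfun \<mu> (?q * mop \<mu> (n - 1) * mop \<mu> n)
       + mfun \<mu> (?q * r * mop \<mu> n)"
    unfolding r(1) ring_distribs mult_smult_left mult_smult_right mfun_lin by simp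
  let ?p = "pcompose (mop \<mu> n) [:1, 1:]"
  have "coeff ([:\<alpha>, 1:] * ?p) n = \<alpha> + of_nat n - rcs \<mu> n" "coeff ([:\<alpha>, 1:] * ?p) (Suc n) = 1"
    unfolding lin_mult coeff_add coeff_smult coeff_mop_shift by (simp_all add: coeff_mop_shift)
  then have R: "mfun \<mu> ([:\<alpha>, 1:] * ?p * mop \<mu> n)
      = (\<alpha> + of_nat n - rcs \<mu> n + rcs \<mu> (Suc n)) * nrm \<mu> n"
    using mop_pair_Suc[OF nz, of n "[:\<alpha>, 1:] * ?p"] degree_lin_mult[OF degree_mop_shift[of \<mu> n 1], of \<alpha>] nz
    by simp
  have s: "of_nat n * rcs \<mu> n = of_nat n * rcs \<mu> (n - 1) + of_nat n * rcb \<mu> (n - 1)"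
    by (cases n) (simp_all add: rcs_Suc algebra_simps)
  \<comment> \<open>The terms in \<open>rcs \<mu> (n - 1)\<close> from \<open>t2\<close> and
    \<open>t3\<close> cancel.\<close>
  have "(rca \<mu> (Suc n) + rca \<mu> n + (rcb \<mu> n)\<^sup>2 + (\<beta> - 1 - of_nat n) * rcb \<mu> n - rcs \<mu> n
      - of_nat n * (\<beta> - 1) + of_nat n * (of_nat n - 1) / 2) * nrm \<mu> n
    = z * (rcb \<mu> n + \<alpha> + of_nat n) * nrm \<mu> n"
    using pearson_shifted[of "mop \<mu> n" "mop \<mu> n"]
    unfolding L R t1 t2 t3 r(3) by (simp add: rcs_Suc algebra_simps)
  then show ?thesis
    using nz by simp
qed

text \<open>Take p = P_n and q = P_{n-1}. Since h_n = a_n h_{n-1}, both sides are multiples of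
  h_{n-1}; for n = 0 both sides of the claim are zero.\<close>

lemma structure_relation_off_diag:
  assumes nz: "\<And>k. k \<le> n \<Longrightarrow> nrm \<mu> k \<noteq> 0"
  shows "rca \<mu> n * (rcb \<mu> n + rcb \<mu> (n - 1) + \<beta> - of_nat n)
     = z * (rca \<mu> n + of_nat n * \<alpha> + of_nat n * (of_nat n - 1) / 2 + rcs \<mu> n)"
proof (cases n)
  case (Suc m)
  let ?q = "[:0, \<beta> - 1, 1:]" and ?l = "[:\<alpha>, 1:]" and ?p = "pcompose (mop \<mu> m) [:-1, 1:]"
  have "coeff (?q * ?p) n = \<beta> - 1 - of_nat m - rcs \<mu> m" "coeff (?q * ?p) (Suc n) = 1"
    using coeff_mop_shift[where \<mu> = \<mu> and n = m and c = "-1"] Suc unfolding quad_mult by simp_all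
  then have L: "mfun \<mu> (?q * ?p * mop \<mu> n)
      = (\<beta> - 1 - of_nat m - rcs \<mu> m + rcs \<mu> (Suc n)) * nrm \<mu> n"
    using mop_pair_Suc[OF nz, of n "?q * ?p"] degree_quad_mult[OF degree_mop_shift[of \<mu> m "-1"]] Suc
    by simp
  obtain r where r: "pcompose (mop \<mu> n) [:1, 1:] = mop \<mu> n + smult (of_nat n * 1) (mop \<mu> (n - 1)) + r"
    "degree (pCons 0 (pCons 0 r)) \<le> n"
    "coeff (pCons 0 (pCons 0 r)) n = of_nat n * (of_nat n - 1) / 2 * 1\<^sup>2
       - (of_nat n - 1) * 1 * rcs \<mu> n + of_nat n * 1 * rcs \<mu> (n - 1)"
    by (rule mop_shift_expansion)
  have nzm: "nrm \<mu> k \<noteq> 0" if "k \<le> m" for k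
    using nz that Suc by simp
  \<comment> \<open>The linear factor is attached to P_m rather than to P_n: the product is monic of
    degree n and is paired with P_n.\<close>
  have t1: "mfun \<mu> (?l * mop \<mu> n * mop \<mu> m) = nrm \<mu> n"
  proof -
    have "mfun \<mu> (?l * mop \<mu> m * mop \<mu> n) = nrm \<mu> n"
      using mop_pair[of n \<mu> "?l * mop \<mu> m"] nz Suc degree_lin_mult[of "mop \<mu> m" m \<alpha>] by simp
    then show ?thesis
      by (simp only: mult_ac)
  qed
  have "mfun \<mu> (mop \<mu> m * mop \<mu> m) = nrm \<mu> m"
    using mop_pair[of m \<mu> "mop \<mu> m"] nzm by simp
  then have t2: "mfun \<mu> (?l * mop \<mu> m * mop \<mu> m) = (\<alpha> + rcb \<mu> m) * nrm \<mu> m"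
    unfolding lin_mult distrib_right mult_smult_left mfun_lin
    using mfun_x_mop[of m \<mu>] nzm
    by (simp add: algebra_simps del: mult_pCons_left mult_pCons_right)
  have r0: "coeff (pCons 0 r) k = 0" if "k > m" for k
    using coeff_eq_0[of "pCons 0 (pCons 0 r)" "Suc k"] r(2) that Suc by simp
  have r1: "coeff r k = 0" if "k \<ge> m" for k
    using r0[of "Suc k"] that by simp
  have "degree (?l * r) \<le> m"
    unfolding lin_mult using r0 r1
    by (intro degree_add_le order.trans[OF degree_smult_le] degree_le allI impI) auto
  moreover have "coeff (?l * r) m = coeff (pCons 0 (pCons 0 r)) n"
    unfolding lin_mult using r1[of m] Suc by simp
  ultimately have t3: "mfun \<mu> (?l * r * mop \<mu> m) = coeff (pCons 0 (pCons 0 r)) n * nrm \<mu> m"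
    using mop_pair[of m \<mu> "?l * r"] nzm by simp
  have R: "mfun \<mu> (?l * pcompose (mop \<mu> n) [:1, 1:] * mop \<mu> m)
     = mfun \<mu> (?l * mop \<mu> n * mop \<mu> m) + of_nat n * mfun \<mu> (?l * mop \<mu> m * mop \<mu> m)
       + mfun \<mu> (?l * r * mop \<mu> m)"
    unfolding r(1) ring_distribs mult_smult_left mult_smult_right mfun_lin using Suc by simp
  have h: "nrm \<mu> n = rca \<mu> n * nrm \<mu> m"
    using rca_Suc[of \<mu> m] nzm Suc by simp
  have "rca \<mu> n * (rcb \<mu> n + rcb \<mu> (n - 1) + \<beta> - of_nat n) * nrm \<mu> m
     = z * (rca \<mu> n + of_nat n * \<alpha> + of_nat n * (of_nat n - 1) / 2 + rcs \<mu> n) * nrm \<mu> m"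
    using pearson_shifted[of "mop \<mu> m" "mop \<mu> n"]
    unfolding L R t1 t2 t3 r(3) h using Suc by (simp add: rcs_Suc algebra_simps)
  then show ?thesis
    using nzm by simp
qed simp

text \<open>A first integral of the two structure relations. It reads 0 = 0 at n = 0, and its
  increment from n to n + 1 is a multiple of the diagonal relation.\<close>

lemma product_relation:
  assumes nz: "\<And>k. k \<le> n \<Longrightarrow> nrm \<mu> k \<noteq> 0"
  shows "rca \<mu> n * (rcb \<mu> n - of_nat n - z) * (rcb \<mu> (n - 1) - of_nat n + 1 - z)
    = (rca \<mu> n - (of_nat n + \<alpha> - \<beta>) * z) * (rca \<mu> n - rcs \<mu> n + of_nat n * (of_nat n - 1) / 2)"
  using assms
proof (induction n)
  case (Suc n)
  define t :: 'a where "t = of_nat n * (of_nat n - 1) / 2"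
  have t': "of_nat (Suc n) * (of_nat (Suc n) - 1) / 2 = t + of_nat n"
    by (simp add: t_def field_simps)
  have I: "rca \<mu> (Suc n) = z * (rcb \<mu> n + \<alpha> + of_nat n) - (rca \<mu> n + (rcb \<mu> n)\<^sup>2
      + (\<beta> - 1 - of_nat n) * rcb \<mu> n - rcs \<mu> n - of_nat n * (\<beta> - 1) + t)"
    using structure_relation_diag[of n] Suc.prems unfolding t_def by (simp add: algebra_simps)
  have II: "rca \<mu> n * (rcb \<mu> n + rcb \<mu> (n - 1) + \<beta> - of_nat n)
     = z * (rca \<mu> n + of_nat n * \<alpha> + t + rcs \<mu> n)"
    using structure_relation_off_diag[of n] Suc.prems unfolding t_def by simp
  have II': "rca \<mu> (Suc n) * (rcb \<mu> (Suc n) + rcb \<mu> n + \<beta> - of_nat n - 1)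
     = z * (rca \<mu> (Suc n) + of_nat n * \<alpha> + \<alpha> + t + of_nat n + rcs \<mu> n + rcb \<mu> n)"
    using structure_relation_off_diag[of "Suc n"] Suc.prems unfolding t' rcs_Suc
    by (simp add: algebra_simps)
  have III: "rca \<mu> n * (rcb \<mu> n - of_nat n - z) * (rcb \<mu> (n - 1) - of_nat n + 1 - z)
    = (rca \<mu> n - (of_nat n + \<alpha> - \<beta>) * z) * (rca \<mu> n - rcs \<mu> n + t)"
    using Suc.IH Suc.prems unfolding t_def by simp
  define N :: 'a where "N = of_nat n"
  define a' where "a' = rca \<mu> (Suc n)"
  define a x S where "a = rca \<mu> n" and "x = rcb \<mu> n" and "S = rcs \<mu> n"
  note defs = N_def[symmetric] a'_def[symmetric] a_def[symmetric] x_def[symmetric] S_def[symmetric]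
  \<comment> \<open>The outer coefficients b_{n-1} and b_{n+1} enter the claim only through these
    products; the off-diagonal relations at n and n + 1 eliminate them.\<close>
  have II1: "a * (rcb \<mu> (n - 1) - N + 1 - z) = z * (N * \<alpha> + t + S) - a * (x + \<beta> - 1)"
    using II unfolding defs by (simp add: algebra_simps)
  have II2: "a' * (rcb \<mu> (Suc n) - N - 1 - z) = z * (N * \<alpha> + \<alpha> + t + N + S + x) - a' * (x + \<beta>)"
    using II' unfolding defs by (simp add: algebra_simps)
  have III': "(x - N - z) * (z * (N * \<alpha> + t + S) - a * (x + \<beta> - 1))
      = (a - (N + \<alpha> - \<beta>) * z) * (a - S + t)"
    using III unfolding II1[symmetric] defs by (simp add: mult_ac)
  have I': "a' + a + x\<^sup>2 + (\<beta> - 1 - N) * x - S - N * (\<beta> - 1) + t = z * (x + \<alpha> + N)"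
    using I unfolding defs by (simp add: algebra_simps)
  have "(x - N - z) * (z * (N * \<alpha> + \<alpha> + t + N + S + x) - a' * (x + \<beta>))
      = (a' - (N + 1 + \<alpha> - \<beta>) * z) * (a' - (S + x) + (t + N))"
  proof -
    \<comment> \<open>Polynomial identity: the defects at n + 1 and at n differ by a_n + z - a_{n+1}
      times the defect of the diagonal relation.\<close>
    have "(x - N - z) * (z * (N * \<alpha> + \<alpha> + t + N + S + x) - a' * (x + \<beta>))
        - (a' - (N + 1 + \<alpha> - \<beta>) * z) * (a' - (S + x) + (t + N))
      = (x - N - z) * (z * (N * \<alpha> + t + S) - a * (x + \<beta> - 1))
        - (a - (N + \<alpha> - \<beta>) * z) * (a - S + t)
        + (a + z - a') * (a' + a + x\<^sup>2 + (\<beta> - 1 - N) * x - S - N * (\<beta> - 1) + t - z * (x + \<alpha> + N))"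
      by (simp add: algebra_simps power2_eq_square)
    then show ?thesis
      using III' I' by simp
  qed
  then have "a' * (rcb \<mu> (Suc n) - N - 1 - z) * (x - N - z)
     = (a' - (N + 1 + \<alpha> - \<beta>) * z) * (a' - (S + x) + (t + N))"
    unfolding II2[symmetric] by (simp add: mult_ac)
  then show ?case
    unfolding t' rcs_Suc N_def a'_def x_def S_def by (simp add: algebra_simps)
qed simp

end

section \<open>Hankel determinants and the Toda flow\<close>

text \<open>The coefficient matrix C is unitriangular, and orthogonality makes C H upper triangular
  with diagonal h_0, ..., h_{n-1}. The last norm may be zero, so that nonzero determinants can be
  turned into nonzero norms one index at a time.\<close>

lemma hankel_det_eq_prod_nrm:
  fixes \<mu> :: "nat \<Rightarrow> 'a::field_char_0"
  assumes nz: "\<And>k. Suc k < n \<Longrightarrow> nrm \<mu> k \<noteq> 0"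
  shows "det (mat n n (\<lambda>(j, k). \<mu> (j + k))) = (\<Prod>k<n. nrm \<mu> k)"
proof -
  let ?H = "mat n n (\<lambda>(j, k). \<mu> (j + k))" and ?C = "mat n n (\<lambda>(i, j). coeff (mop \<mu> i) j)"
  have ent: "(?C * ?H) $$ (i, j) = mfun \<mu> (monom 1 j * mop \<mu> i)" if "i < n" "j < n" for i j
  proof -
    have "(?C * ?H) $$ (i, j) = (\<Sum>k<n. coeff (mop \<mu> i) k * \<mu> (k + j))"
      using that by (simp add: scalar_prod_def atLeast0LessThan)
    also have "\<dots> = (\<Sum>k\<le>i. coeff (mop \<mu> i) k * \<mu> (k + j))"
      using that by (intro sum.mono_neutral_right) auto
    finally show ?thesis
      by (simp add: mfun_monom_mult[where N = i])
  qed
  have "det ?C = (\<Prod>k<n. 1)"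
    by (subst det_lower_triangular[where n = n]) (auto simp: prod_list_diag_prod atLeast0LessThan)
  moreover have "det (?C * ?H) = (\<Prod>k<n. nrm \<mu> k)"
  proof -
    have "upper_triangular (?C * ?H)"
      unfolding upper_triangular_def
    proof (intro allI impI)
      fix i j assume ij: "i < dim_row (?C * ?H)" "j < i"
      have "mfun \<mu> (monom 1 j * mop \<mu> i) = 0"
        using ij by (intro mop_orth_monom[where n = "n - 1"] nz) auto
      then show "(?C * ?H) $$ (i, j) = 0"
        using ij by (subst ent) auto
    qed
    then have "det (?C * ?H) = prod_list (diag_mat (?C * ?H))"
      by (rule det_upper_triangular[where n = n]) (rule mult_carrier_mat[where n = n]; simp)
    also have "\<dots> = (\<Prod>k<n. (?C * ?H) $$ (k, k))"
      by (simp add: prod_list_diag_prod atLeast0LessThan del: index_mult_mat(1))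
    also have "\<dots> = (\<Prod>k<n. nrm \<mu> k)"
      unfolding nrm_def by (intro prod.cong refl ent) auto
    finally show ?thesis .
  qed
  moreover have "det (?C * ?H) = det ?C * det ?H"
    by (rule det_mult[where n = n]) auto
  ultimately show ?thesis
    by simp
qed

section \<open>The Toda flow: dependence of the polynomials on z\<close>

locale toda =
  fixes \<mu> :: "nat \<Rightarrow> complex \<Rightarrow> complex" and N :: nat and D :: "complex set"
  assumes D: "open D"
    and hol: "\<mu> j holomorphic_on D"
    and flow: "z \<in> D \<Longrightarrow> z * deriv (\<mu> j) z = \<mu> (Suc j) z"
    and nz: "z \<in> D \<Longrightarrow> k \<le> N \<Longrightarrow> nrm (\<lambda>j. \<mu> j z) k \<noteq> 0"
begin

abbreviation mo :: "complex \<Rightarrow> nat \<Rightarrow> complex" where "mo z \<equiv> (\<lambda>j. \<mu> j z)"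

lemma holomorphic_mfun:
  assumes "\<And>i. (\<lambda>z. coeff (p z) i) holomorphic_on D" "\<And>z. degree (p z) \<le> n"
  shows "(\<lambda>z. mfun (mo z) (monom 1 j * p z)) holomorphic_on D"
  unfolding mfun_monom_mult[OF assms(2)] by (intro holomorphic_intros assms hol)

lemma holomorphic_coeffs:
  assumes "\<And>i. (\<lambda>z. coeff (mop (mo z) n) i) holomorphic_on D"
    "\<And>i. (\<lambda>z. coeff (mop (mo z) (n - 1)) i) holomorphic_on D" and "n \<le> N"
  shows "(\<lambda>z. nrm (mo z) n) holomorphic_on D" "(\<lambda>z. rca (mo z) n) holomorphic_on D"
    "(\<lambda>z. rcb (mo z) n) holomorphic_on D"
proof -
  have *: "(\<lambda>z. mfun (mo z) (monom 1 j * mop (mo z) n)) holomorphic_on D"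
    "(\<lambda>z. mfun (mo z) (monom 1 j * mop (mo z) (n - 1))) holomorphic_on D" for j
    by (intro holomorphic_mfun[where n = n] assms; simp)+
  show 1: "(\<lambda>z. nrm (mo z) n) holomorphic_on D"
    unfolding nrm_def by (rule *)
  have 2: "(\<lambda>z. nrm (mo z) (n - 1)) holomorphic_on D"
    unfolding nrm_def by (rule *)
  show 3: "(\<lambda>z. rca (mo z) n) holomorphic_on D"
    unfolding rca_def using 1 2 nz assms(3) by (cases "n = 0") (auto intro!: holomorphic_intros)
  show "(\<lambda>z. rcb (mo z) n) holomorphic_on D"
    unfolding rcb_def by (intro holomorphic_intros * 1 3 nz assms)
qed

text \<open>P_{N+1} divides only by h_0, ..., h_N, hence the bound \<open>Suc N\<close> although the
  norms are controlled only up to \<open>N\<close>.\<close>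

lemma holomorphic_coeff_mop:
  "n \<le> Suc N \<Longrightarrow> (\<lambda>z. coeff (mop (mo z) n) i) holomorphic_on D"
proof (induction n arbitrary: i rule: less_induct)
  case (less n)
  show ?case
  proof (cases n)
    case (Suc m)
    have IH: "(\<lambda>z. coeff (mop (mo z) m) i) holomorphic_on D"
      "(\<lambda>z. coeff (mop (mo z) (m - 1)) i) holomorphic_on D" for i
      using less Suc by auto
    have "m \<le> N" using less Suc by simp
    note hc = holomorphic_coeffs[OF IH this]
    have "(\<lambda>z. coeff (pCons 0 (mop (mo z) m)) i) holomorphic_on D"
      by (cases i) (auto intro!: IH)
    then show ?thesis
      unfolding Suc mop_Suc lin_mult coeff_add coeff_diff coeff_smult
      by (intro holomorphic_intros IH hc)
  qed auto
qed

lemma holomorphic_nrm: "n \<le> N \<Longrightarrow> (\<lambda>z. nrm (mo z) n) holomorphic_on D"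
  and holomorphic_rca: "n \<le> N \<Longrightarrow> (\<lambda>z. rca (mo z) n) holomorphic_on D"
  by (rule holomorphic_coeffs; (rule holomorphic_coeff_mop)?; simp)+

lemma holomorphic_rcs: "n \<le> Suc N \<Longrightarrow> (\<lambda>z. rcs (mo z) n) holomorphic_on D"
  unfolding rcs_def
  by (intro holomorphic_intros; rule holomorphic_coeffs; (rule holomorphic_coeff_mop)?; simp)

text \<open>The polynomial z dP_n/dz, differentiated coefficientwise in the parameter z.\<close>

definition dmop :: "nat \<Rightarrow> complex \<Rightarrow> complex poly" where
  "dmop n z = (\<Sum>i\<le>n. monom (z * deriv (\<lambda>w. coeff (mop (mo w) n) i) z) i)"

lemma coeff_dmop: "coeff (dmop n z) i = z * deriv (\<lambda>w. coeff (mop (mo w) n) i) z"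
  by (cases "i \<le> n") (auto simp: dmop_def coeff_sum)

text \<open>Product rule: by the flow, differentiating the moments multiplies by the polynomial
  variable, and the rest acts on the coefficients of P_n.\<close>

lemma deriv_mfun_mop:
  assumes z: "z \<in> D" and n: "n \<le> Suc N"
  shows "z * deriv (\<lambda>w. mfun (mo w) (monom 1 j * mop (mo w) n)) z
     = mfun (mo z) (monom 1 (Suc j) * mop (mo z) n) + mfun (mo z) (monom 1 j * dmop n z)"
proof -
  have d: "degree (dmop n z) \<le> n"
    unfolding dmop_def by (intro degree_sum_le order.trans[OF degree_monom_le]) auto
  have "((\<lambda>w. \<Sum>i\<le>n. coeff (mop (mo w) n) i * \<mu> (i + j) w) has_field_derivative
      (\<Sum>i\<le>n. coeff (mop (mo z) n) i * deriv (\<mu> (i + j)) z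
         + deriv (\<lambda>w. coeff (mop (mo w) n) i) z * \<mu> (i + j) z)) (at z)"
    by (intro DERIV_sum DERIV_mult' holomorphic_derivI[OF _ D z] hol holomorphic_coeff_mop n)
  then have "deriv (\<lambda>w. \<Sum>i\<le>n. coeff (mop (mo w) n) i * \<mu> (i + j) w) z =
      (\<Sum>i\<le>n. coeff (mop (mo z) n) i * deriv (\<mu> (i + j)) z
         + deriv (\<lambda>w. coeff (mop (mo w) n) i) z * \<mu> (i + j) z)"
    by (rule DERIV_imp_deriv)
  then have "z * deriv (\<lambda>w. \<Sum>i\<le>n. coeff (mop (mo w) n) i * \<mu> (i + j) w) z
    = (\<Sum>i\<le>n. coeff (mop (mo z) n) i * (z * deriv (\<mu> (i + j)) z)
         + z * deriv (\<lambda>w. coeff (mop (mo w) n) i) z * \<mu> (i + j) z)"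
    by (simp add: sum_distrib_left algebra_simps)
  then show ?thesis
    by (simp add: mfun_monom_mult[where N = n] d coeff_dmop flow[OF z] sum.distrib)
qed

lemma mfun_mop_orth:
  assumes z: "z \<in> D" and "n \<le> Suc N" "j < n"
  shows "mfun (mo z) (monom 1 j * mop (mo z) n) = 0"
  using assms by (intro mop_orth_monom[where n = n] nz) auto

text \<open>P_n being monic, z dP_n/dz has degree below n, and differentiating L[x^j P_n] = 0 shows
  that adding a_n P_{n-1} makes it orthogonal to all x^j with j < n. With nonzero norms such a
  polynomial is zero.\<close>

lemma dmop_eq:
  assumes z: "z \<in> D" and n: "n \<le> Suc N"
  shows "dmop n z = - smult (rca (mo z) n) (mop (mo z) (n - 1))"
proof (cases n)
  case 0
  then show ?thesis by (simp add: dmop_def)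
next
  case (Suc m)
  define q where "q = dmop n z + smult (rca (mo z) n) (mop (mo z) m)"
  have cq: "coeff q k = 0" if "k > m" for k
  proof -
    have "(\<lambda>w. coeff (mop (mo w) n) k) = (\<lambda>w. if k = n then 1 else 0)"
      using that Suc by auto
    then have "coeff (dmop n z) k = 0"
      by (simp add: coeff_dmop)
    then show ?thesis
      using that by (simp add: q_def)
  qed
  then have dq: "degree q \<le> m"
    by (intro degree_le) auto
  have L: "mfun (mo z) (monom 1 j * q) = 0" if "j \<le> m" for j
  proof -
    have "deriv (\<lambda>w. mfun (mo w) (monom 1 j * mop (mo w) n)) z = deriv (\<lambda>w. 0) z"
      by (rule complex_derivative_transform_within_open[OF _ _ D z])
         (use that n Suc in \<open>auto intro!: holomorphic_mfun[where n = n] holomorphic_coeff_mop mfun_mop_orth\<close>)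
    then have 1: "mfun (mo z) (monom 1 j * dmop n z) = - mfun (mo z) (monom 1 (Suc j) * mop (mo z) n)"
      using deriv_mfun_mop[OF z n, of j] by (simp add: eq_neg_iff_add_eq_0 add.commute)
    show ?thesis
    proof (cases "j = m")
      \<comment> \<open>Here L[x^(m+1) P_n] = h_n = a_n h_m balances the added term.\<close>
      case True
      then show ?thesis
        using 1 Suc rca_Suc[of "mo z" m] nz[OF z, of m] n
        by (simp add: q_def ring_distribs mfun_lin nrm_def)
    next
      case False
      then show ?thesis
        using 1 Suc that mfun_mop_orth[OF z n, of "Suc j"] mfun_mop_orth[OF z, of m j] n
        by (simp add: q_def ring_distribs mfun_lin)
    qed
  qed
  have "coeff q (degree q) * nrm (mo z) (degree q) = mfun (mo z) (q * mop (mo z) (degree q))"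
    using dq n Suc by (intro mop_pair[symmetric] nz z) auto
  also have "\<dots> = mfun (mo z) (mop (mo z) (degree q) * q)"
    by (simp add: mult.commute)
  also have "\<dots> = 0"
    using dq by (subst mfun_mult[where N = "degree q"]) (auto intro!: sum.neutral L)
  finally have "q = 0"
    using nz[OF z, of "degree q"] dq n Suc by simp
  then show ?thesis
    using Suc by (simp add: q_def eq_neg_iff_add_eq_0)
qed

text \<open>The flow gives L[x^(n+1) P_n] - a_n L[x^n P_{n-1}], the numerator of
  \<open>rcb\<close>.\<close>

lemma deriv_nrm:
  assumes z: "z \<in> D" and n: "n \<le> N"
  shows "z * deriv (\<lambda>w. nrm (mo w) n) z = rcb (mo z) n * nrm (mo z) n"
  using deriv_mfun_mop[OF z, of n n] n nz[OF z n]
  by (simp add: nrm_def dmop_eq[OF z] mfun_lin mfun_minus rcb_def)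

text \<open>Compares the coefficients of x^(n-1) in the Toda flow.\<close>

lemma deriv_rcs:
  assumes z: "z \<in> D" and n: "n \<le> Suc N"
  shows "z * deriv (\<lambda>w. rcs (mo w) n) z = rca (mo z) n"
proof (cases n)
  case (Suc m)
  have "(\<lambda>w. rcs (mo w) n) = (\<lambda>w. - coeff (mop (mo w) n) m)"
    using Suc by (simp add: coeff_mop_sub)
  moreover have "deriv (\<lambda>w. - coeff (mop (mo w) n) m) z = - deriv (\<lambda>w. coeff (mop (mo w) n) m) z"
    by (intro DERIV_imp_deriv DERIV_minus holomorphic_derivI[OF _ D z] holomorphic_coeff_mop n)
  ultimately have "z * deriv (\<lambda>w. rcs (mo w) n) z = - coeff (dmop n z) m"
    by (simp add: coeff_dmop)
  then show ?thesis
    using Suc dmop_eq[OF z n] by simp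
qed simp

lemma deriv_rca:
  assumes z: "z \<in> D" and n: "n \<le> N"
  shows "z * deriv (\<lambda>w. rca (mo w) n) z = rca (mo z) n * (rcb (mo z) n - rcb (mo z) (n - 1))"
proof (cases n)
  case (Suc m)
  have eq: "(\<lambda>w. rca (mo w) n) = (\<lambda>w. nrm (mo w) n / nrm (mo w) m)"
    using Suc by (simp add: rca_def)
  have m: "m \<le> N" using n Suc by simp
  have "deriv (\<lambda>w. nrm (mo w) n / nrm (mo w) m) z
    = (deriv (\<lambda>w. nrm (mo w) n) z * nrm (mo z) m - nrm (mo z) n * deriv (\<lambda>w. nrm (mo w) m) z)
       / (nrm (mo z) m * nrm (mo z) m)"
    by (intro DERIV_imp_deriv DERIV_divide holomorphic_derivI[OF _ D z] holomorphic_nrm n m nz z)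
  then have "z * deriv (\<lambda>w. rca (mo w) n) z
    = ((z * deriv (\<lambda>w. nrm (mo w) n) z) * nrm (mo z) m - nrm (mo z) n * (z * deriv (\<lambda>w. nrm (mo w) m) z))
       / (nrm (mo z) m * nrm (mo z) m)"
    unfolding eq by (simp only: times_divide_eq_right right_diff_distrib mult_ac)
  also have "\<dots> = rca (mo z) n * (rcb (mo z) n - rcb (mo z) m)"
    using nz[OF z m] Suc unfolding deriv_nrm[OF z n] deriv_nrm[OF z m] by (simp add: rca_def field_simps)
  finally show ?thesis
    using Suc by simp
qed simp

text \<open>The Hankel determinant is this product, so its logarithmic derivative b_0 + ... +
  b_{n-1} identifies S_n with \<open>rcs\<close>.\<close>

lemma deriv_prod_nrm:
  assumes z: "z \<in> D" and n: "n \<le> Suc N"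
  shows "z * deriv (\<lambda>w. \<Prod>k<n. nrm (mo w) k) z = rcs (mo z) n * (\<Prod>k<n. nrm (mo z) k)"
  using n
proof (induction n)
  case (Suc n)
  have "deriv (\<lambda>w. (\<Prod>k<n. nrm (mo w) k) * nrm (mo w) n) z
    = (\<Prod>k<n. nrm (mo z) k) * deriv (\<lambda>w. nrm (mo w) n) z
      + deriv (\<lambda>w. \<Prod>k<n. nrm (mo w) k) z * nrm (mo z) n"
    using Suc.prems
    by (intro DERIV_imp_deriv DERIV_mult' holomorphic_derivI[OF _ D z] holomorphic_intros holomorphic_nrm) auto
  then have "z * deriv (\<lambda>w. \<Prod>k<Suc n. nrm (mo w) k) z
    = (\<Prod>k<n. nrm (mo z) k) * (z * deriv (\<lambda>w. nrm (mo w) n) z)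
      + (z * deriv (\<lambda>w. \<Prod>k<n. nrm (mo w) k) z) * nrm (mo z) n"
    by (simp add: algebra_simps)
  also have "\<dots> = rcs (mo z) (Suc n) * (\<Prod>k<Suc n. nrm (mo z) k)"
    using Suc deriv_nrm[OF z, of n] by (simp add: rcs_Suc algebra_simps)
  finally show ?case .
qed simp

text \<open>The flow expresses S' and S'' through a_n, b_n and b_{n-1}; the off-diagonal relation
  rewrites the squared bracket and the product relation the last term. Agreement of \<open>S\<close>
  with \<open>rcs\<close> on the open set \<open>D\<close> determines its derivatives there.\<close>

lemma sigma_equation:
  assumes z: "z \<in> D" and n: "n \<le> N" and D0: "0 \<notin> D"
    and P: "\<And>w. w \<in> D \<Longrightarrow> pearson (mo w) \<alpha> \<beta> w"
    and S: "\<And>w. w \<in> D \<Longrightarrow> S w = rcs (mo w) n"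
  shows "(z * deriv (deriv S) z)\<^sup>2 =
     ((z + of_nat n + \<beta> - 1) * deriv S z - S z - of_nat n * (of_nat n - 1 + 2 * \<alpha>) / 2)\<^sup>2
       - 4 * deriv S z * (deriv S z - of_nat n - \<alpha> + \<beta>)
         * (z * deriv S z - S z + of_nat n * (of_nat n - 1) / 2)"
proof -
  define a where "a = rca (mo z) n"
  define x where "x = rcb (mo z) n"
  define y where "y = rcb (mo z) (n - 1)"
  define m :: complex where "m = of_nat n"
  have z0: "z \<noteq> 0" using z D0 by auto
  have hS: "S holomorphic_on D"
    using holomorphic_rcs[of n] n S by (auto intro: holomorphic_transform)
  have S1: "deriv S w = rca (mo w) n / w" if w: "w \<in> D" for w
  proof -
    have "deriv S w = deriv (\<lambda>w. rcs (mo w) n) w"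
      using n by (intro complex_derivative_transform_within_open[OF hS _ D w] holomorphic_rcs S) auto
    moreover have "w \<noteq> 0"
      using w D0 by auto
    ultimately show ?thesis
      using deriv_rcs[OF w, of n] n by (simp add: nonzero_eq_divide_eq mult.commute)
  qed
  have "deriv (deriv S) z = deriv (\<lambda>w. rca (mo w) n / w) z"
    by (intro complex_derivative_transform_within_open[OF _ _ D z] S1 holomorphic_intros
        holomorphic_deriv hS D holomorphic_rca n) (use D0 in auto)
  also have "\<dots> = (deriv (\<lambda>w. rca (mo w) n) z * z - a * 1) / (z * z)"
    unfolding a_def
    by (intro DERIV_imp_deriv DERIV_divide holomorphic_derivI[OF _ D z] holomorphic_rca n DERIV_ident z0)
  finally have "z * deriv (deriv S) z = (z * deriv (\<lambda>w. rca (mo w) n) z - a) / z"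
    using z0 by (simp add: field_simps)
  then have S2: "z * deriv (deriv S) z = a * (x - y - 1) / z"
    unfolding deriv_rca[OF z n] a_def x_def y_def by (simp add: algebra_simps)
  have S1z: "deriv S z = a / z"
    using S1[OF z] by (simp add: a_def)
  interpret pearson "mo z" \<alpha> \<beta> z
    by (rule P[OF z])
  have nz': "nrm (mo z) k \<noteq> 0" if "k \<le> n" for k
    using nz[OF z] that n by simp
  have II: "a * (x + y + \<beta> - m) = z * (a + m * \<alpha> + m * (m - 1) / 2 + S z)"
    using structure_relation_off_diag[of n] nz' S[OF z] unfolding a_def x_def y_def m_def by simp
  have III: "a * (x - m - z) * (y - m + 1 - z) = (a - (m + \<alpha> - \<beta>) * z) * (a - S z + m * (m - 1) / 2)"
    using product_relation[of n] nz' S[OF z] unfolding a_def x_def y_def m_def by simp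
  define s where "s = S z"
  have A: "(z + m + \<beta> - 1) * (a / z) - s - m * (m - 1 + 2 * \<alpha>) / 2 = a * (2 * z + 2 * m - 1 - x - y) / z"
  proof -
    have "(z + m + \<beta> - 1) * (a / z) - s - m * (m - 1 + 2 * \<alpha>) / 2
       = ((z + m + \<beta> - 1) * a - z * (s + m * (m - 1 + 2 * \<alpha>) / 2)) / z"
      using z0 by (simp add: diff_divide_distrib add_divide_distrib algebra_simps)
    also have "(z + m + \<beta> - 1) * a - z * (s + m * (m - 1 + 2 * \<alpha>) / 2) = a * (2 * z + 2 * m - 1 - x - y)"
      using II unfolding s_def[symmetric] by (simp add: field_simps)
    finally show ?thesis .
  qed
  have B: "4 * (a / z) * (a / z - m - \<alpha> + \<beta>) * (z * (a / z) - s + m * (m - 1) / 2)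
      = 4 * a * ((a - (m + \<alpha> - \<beta>) * z) * (a - s + m * (m - 1) / 2)) / z\<^sup>2"
    using z0 by (simp add: field_simps power2_eq_square)
  \<comment> \<open>With u = x - m - z and v = y - m + 1 - z this is (u - v)^2 = (u + v)^2 - 4 u v,
    scaled by (a / z)^2.\<close>
  have "(a * (x - y - 1) / z)\<^sup>2 = (a * (2 * z + 2 * m - 1 - x - y) / z)\<^sup>2
      - 4 * a * (a * (x - m - z) * (y - m + 1 - z)) / z\<^sup>2"
    using z0 by (simp add: field_simps power2_eq_square)
  then show ?thesis
    unfolding S2 S1z m_def[symmetric] s_def[symmetric] A B III[unfolded s_def[symmetric]] .
qed

end

section \<open>Moments of the Kummer weight\<close>

definition kcoef :: "real \<Rightarrow> real \<Rightarrow> nat \<Rightarrow> real" where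
  "kcoef a b k = pochhammer a k / (pochhammer b k * fact k)"

definition kmom :: "real \<Rightarrow> real \<Rightarrow> nat \<Rightarrow> complex \<Rightarrow> complex" where
  "kmom a b j z = (\<Sum>k. of_real (kcoef a b k * real k ^ j) * z ^ k)"

locale kummer_weight =
  fixes \<alpha> \<beta> :: real
  assumes \<alpha>: "\<alpha> > 0" and \<beta>: "\<beta> > 0"
begin

lemma kcoef_pos: "kcoef \<alpha> \<beta> k > 0"
  unfolding kcoef_def using \<alpha> \<beta> by (intro divide_pos_pos mult_pos_pos pochhammer_pos) auto

lemma kcoef_Suc: "(\<beta> + real k) * (1 + real k) * kcoef \<alpha> \<beta> (Suc k) = (\<alpha> + real k) * kcoef \<alpha> \<beta> k"
proof -
  have "\<beta> + real k \<noteq> 0" "pochhammer \<beta> k \<noteq> 0"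
    using \<beta> pochhammer_pos[of \<beta> k] by auto
  then show ?thesis
    by (simp add: kcoef_def pochhammer_Suc divide_simps)
qed

text \<open>Ratio test for j = 0; each further power of k comes from termwise differentiation
  followed by multiplication by z.\<close>

lemma summable_kmom: "summable (\<lambda>k. of_real (kcoef \<alpha> \<beta> k * real k ^ j) * (z :: complex) ^ k)"
proof (induction j arbitrary: z)
  case 0
  \<comment> \<open>\<open>C\<close> bounds (\<alpha> + k) / (\<beta> + k), so the ratio of
    consecutive terms is at most C |z| / (1 + k), which is at most 1/2 from the chosen threshold
    on.\<close>
  define C where "C = 1 + \<alpha> / \<beta>"
  have ratio: "norm (complex_of_real (kcoef \<alpha> \<beta> (Suc k)) * z ^ Suc k)
      \<le> 1 / 2 * norm (complex_of_real (kcoef \<alpha> \<beta> k) * z ^ k)" if "k \<ge> nat \<lceil>2 * C * norm z\<rceil>" for k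
  proof -
    have "\<alpha> + real k \<le> C * (\<beta> + real k)"
      using \<alpha> \<beta> by (simp add: C_def field_simps)
    then have "(\<beta> + real k) * (1 + real k) * kcoef \<alpha> \<beta> (Suc k) \<le> (\<beta> + real k) * (C * kcoef \<alpha> \<beta> k)"
      unfolding kcoef_Suc using mult_right_mono[of _ _ "kcoef \<alpha> \<beta> k"] kcoef_pos[of k] by (simp add: mult_ac)
    then have 1: "(1 + real k) * kcoef \<alpha> \<beta> (Suc k) \<le> C * kcoef \<alpha> \<beta> k"
      using \<beta> by (simp add: mult.assoc mult_le_cancel_left_pos)
    have 2: "2 * C * norm z \<le> 1 + real k"
      using that by linarith
    have "(1 + real k) * (kcoef \<alpha> \<beta> (Suc k) * norm z) \<le> C * kcoef \<alpha> \<beta> k * norm z"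
      using mult_right_mono[OF 1, of "norm z"] by (simp add: mult_ac)
    also have "\<dots> \<le> (1 + real k) * (1 / 2 * kcoef \<alpha> \<beta> k)"
      using mult_right_mono[OF 2, of "kcoef \<alpha> \<beta> k"] kcoef_pos[of k] by (simp add: mult_ac)
    finally have "kcoef \<alpha> \<beta> (Suc k) * norm z \<le> 1 / 2 * kcoef \<alpha> \<beta> k"
      by (simp add: mult_le_cancel_left_pos)
    then show ?thesis
      using mult_right_mono[of "kcoef \<alpha> \<beta> (Suc k) * norm z" "1 / 2 * kcoef \<alpha> \<beta> k" "norm z ^ k"]
        kcoef_pos[of k] kcoef_pos[of "Suc k"]
      by (simp add: norm_mult norm_power mult_ac)
  qed
  show ?case
    by (rule summable_ratio_test[of "1/2" "nat \<lceil>2 * C * norm z\<rceil>"]) (use ratio in auto)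
next
  case (Suc j)
  have "summable (\<lambda>n. diffs (\<lambda>k. complex_of_real (kcoef \<alpha> \<beta> k * real k ^ j)) n * z ^ n)"
    by (rule termdiff_converges_all) (rule Suc)
  then have "summable (\<lambda>n. z * (diffs (\<lambda>k. complex_of_real (kcoef \<alpha> \<beta> k * real k ^ j)) n * z ^ n))"
    by (rule summable_mult)
  then have "summable (\<lambda>n. of_real (kcoef \<alpha> \<beta> (Suc n) * real (Suc n) ^ Suc j) * z ^ Suc n)"
    by (simp add: diffs_def mult_ac)
  then show ?case
    by (subst (asm) summable_Suc_iff)
qed

lemma kmom_deriv:
  "(kmom \<alpha> \<beta> j has_field_derivative
     (\<Sum>n. diffs (\<lambda>k. of_real (kcoef \<alpha> \<beta> k * real k ^ j)) n * z ^ n)) (at z)"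
  unfolding kmom_def by (rule termdiffs_strong_converges_everywhere) (rule summable_kmom)

lemma kmom_holomorphic: "kmom \<alpha> \<beta> j holomorphic_on A"
  using kmom_deriv by (meson field_differentiable_at_within field_differentiable_def holomorphic_on_def)

lemma kmom_flow: "z * deriv (kmom \<alpha> \<beta> j) z = kmom \<alpha> \<beta> (Suc j) z"
proof -
  let ?c = "\<lambda>k. complex_of_real (kcoef \<alpha> \<beta> k * real k ^ j)"
  have "summable (\<lambda>n. diffs ?c n * z ^ n)"
    by (rule termdiff_converges_all) (rule summable_kmom)
  then have "z * (\<Sum>n. diffs ?c n * z ^ n) = (\<Sum>n. z * (diffs ?c n * z ^ n))"
    by (rule suminf_mult[symmetric])
  also have "\<dots> = (\<Sum>n. of_real (kcoef \<alpha> \<beta> (Suc n) * real (Suc n) ^ Suc j) * z ^ Suc n)"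
    by (simp add: diffs_def mult_ac)
  \<comment> \<open>The omitted term at k = 0 carries the factor \<open>0 ^ Suc j\<close>, which is
    0.\<close>
  also have "\<dots> = kmom \<alpha> \<beta> (Suc j) z"
    unfolding kmom_def using suminf_split_head[OF summable_kmom[of "Suc j" z]] by simp
  finally show ?thesis
    using DERIV_imp_deriv[OF kmom_deriv] by simp
qed

lemma euler_op_kummerM: "(euler_op ^^ j) (kummerM (of_real \<alpha>) (of_real \<beta>)) = kmom \<alpha> \<beta> j"
proof (induction j)
  case 0
  show ?case
    by (simp add: fun_eq_iff kummerM_def kmom_def kcoef_def pochhammer_of_real)
next
  case (Suc j)
  then show ?case
    by (simp add: euler_op_def kmom_flow)
qed

section \<open>The Hankel determinant and the moment functional of the Kummer weight\<close>

lemma DeltaK_eq: "DeltaK n \<alpha> \<beta> z = det (mat n n (\<lambda>(j, k). kmom \<alpha> \<beta> (j + k) z))"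
  by (simp add: DeltaK_def hankelW_def euler_op_kummerM)

lemma DeltaK_holomorphic: "DeltaK n \<alpha> \<beta> holomorphic_on A"
proof -
  have "DeltaK n \<alpha> \<beta> = (\<lambda>z. \<Sum>p | p permutes {0..<n}. signof p * (\<Prod>i = 0..<n. kmom \<alpha> \<beta> (i + p i) z))"
    unfolding fun_eq_iff DeltaK_eq det_def by (auto intro!: sum.cong prod.cong simp: permutes_in_image)
  then show ?thesis
    by (auto intro!: holomorphic_intros kmom_holomorphic)
qed

text \<open>Exchanging a finite sum with a series identifies the abstract moment functional with
  summation of \<open>p\<close> against the weight.\<close>

lemma mfun_kmom:
  "(\<lambda>k. of_real (kcoef \<alpha> \<beta> k) * z ^ k * poly p (of_nat k)) sums mfun (\<lambda>j. kmom \<alpha> \<beta> j z) p"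
proof -
  have "(\<lambda>k. \<Sum>i\<le>degree p. coeff p i * (of_real (kcoef \<alpha> \<beta> k * real k ^ i) * z ^ k))
      sums (\<Sum>i\<le>degree p. coeff p i * kmom \<alpha> \<beta> i z)"
    unfolding kmom_def by (intro sums_sum sums_mult summable_sums summable_kmom)
  then show ?thesis
    by (simp add: mfun_def poly_altdef sum_distrib_left mult_ac)
qed

lemma pearson_kmom: "pearson (\<lambda>j. kmom \<alpha> \<beta> j z) (of_real \<alpha>) (of_real \<beta>) z"
proof
  fix f :: "complex poly"
  let ?T = "\<lambda>k. complex_of_real (kcoef \<alpha> \<beta> k) * z ^ k * poly ([:0, of_real \<beta> - 1, 1:] * f) (of_nat k)"
  let ?R = "\<lambda>k. complex_of_real (kcoef \<alpha> \<beta> k) * z ^ k * poly ([:of_real \<alpha>, 1:] * pcompose f [:1, 1:]) (of_nat k)"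
  have "?T (Suc k) = z * ?R k" for k
  proof -
    have "(of_real \<beta> + of_nat k) * (1 + of_nat k) * complex_of_real (kcoef \<alpha> \<beta> (Suc k))
        = (of_real \<alpha> + of_nat k) * complex_of_real (kcoef \<alpha> \<beta> k)"
      using arg_cong[OF kcoef_Suc[of k], of complex_of_real] by simp
    moreover have "?T (Suc k) = ((of_real \<beta> + of_nat k) * (1 + of_nat k) * complex_of_real (kcoef \<alpha> \<beta> (Suc k)))
        * z ^ Suc k * poly f (1 + of_nat k)"
      by (simp add: algebra_simps)
    moreover have "z * ?R k = ((of_real \<alpha> + of_nat k) * complex_of_real (kcoef \<alpha> \<beta> k))
        * z ^ Suc k * poly f (1 + of_nat k)"
      by (simp add: poly_pcompose algebra_simps)
    ultimately show ?thesis
      by (simp only:)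
  qed
  then have T: "(\<lambda>k. ?T (Suc k)) = (\<lambda>k. z * ?R k)"
    by (rule ext)
  \<comment> \<open>The term at k = 0 is zero because the quadratic contains the factor x, so the
    shifted series has the same sum.\<close>
  have "(\<lambda>k. ?T (Suc k)) sums mfun (\<lambda>j. kmom \<alpha> \<beta> j z) ([:0, of_real \<beta> - 1, 1:] * f)"
    using mfun_kmom[of z "[:0, of_real \<beta> - 1, 1:] * f"] by (subst sums_Suc_iff) simp
  moreover have "(\<lambda>k. z * ?R k) sums (z * mfun (\<lambda>j. kmom \<alpha> \<beta> j z) ([:of_real \<alpha>, 1:] * pcompose f [:1, 1:]))"
    by (intro sums_mult mfun_kmom)
  ultimately show "mfun (\<lambda>j. kmom \<alpha> \<beta> j z) ([:0, of_real \<beta> - 1, 1:] * f)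
      = z * mfun (\<lambda>j. kmom \<alpha> \<beta> j z) ([:of_real \<alpha>, 1:] * pcompose f [:1, 1:])"
    unfolding T by (rule sums_unique2)
qed

text \<open>At z = 1 the weight is positive. If h_k were zero, pairing P_k with its conjugate would
  give a vanishing sum of nonnegative terms, so P_k would vanish at every natural number.
  Conjugation avoids showing that the coefficients are real.\<close>

lemma nrm_kmom_1: "nrm (\<lambda>j. kmom \<alpha> \<beta> j 1) k \<noteq> 0"
proof (induction k rule: less_induct)
  case (less k)
  let ?\<mu> = "\<lambda>j. kmom \<alpha> \<beta> j 1"
  let ?p = "mop ?\<mu> k"
  show ?case
  proof
    assume "nrm ?\<mu> k = 0"
    then have "mfun ?\<mu> (map_poly cnj ?p * ?p) = 0"
      using mop_pair[of k ?\<mu> "map_poly cnj ?p"] less.IH by (simp add: degree_map_poly)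
    then have "(\<lambda>i. of_real (kcoef \<alpha> \<beta> i) * 1 ^ i * poly (map_poly cnj ?p * ?p) (of_nat i)) sums 0"
      using mfun_kmom[of 1 "map_poly cnj ?p * ?p"] by simp
    moreover have "of_real (kcoef \<alpha> \<beta> i) * 1 ^ i * poly (map_poly cnj ?p * ?p) (of_nat i)
        = complex_of_real (kcoef \<alpha> \<beta> i * (norm (poly ?p (of_nat i)))\<^sup>2)" for i
      using poly_cnj[of ?p "of_nat i"] complex_norm_square[of "poly ?p (of_nat i)"]
      by (simp add: mult_ac)
    ultimately have "(\<lambda>i. complex_of_real (kcoef \<alpha> \<beta> i * (norm (poly ?p (of_nat i)))\<^sup>2)) sums of_real 0"
      by (simp only: of_real_0)
    then have s: "(\<lambda>i. kcoef \<alpha> \<beta> i * (norm (poly ?p (of_nat i)))\<^sup>2) sums 0"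
      by (simp only: sums_of_real_iff)
    have w: "kcoef \<alpha> \<beta> i * (norm (poly ?p (of_nat i)))\<^sup>2 = 0" for i
      using suminf_eq_zero_iff[OF sums_summable[OF s]] sums_unique[OF s] kcoef_pos by (simp add: less_imp_le)
    have "poly ?p (of_nat i) = 0" for i
      using w[of i] kcoef_pos[of i] by auto
    then have "range of_nat \<subseteq> {x. poly ?p x = 0}"
      by auto
    moreover have "infinite (range (of_nat :: nat \<Rightarrow> complex))"
      by (rule range_inj_infinite) (simp add: inj_on_def)
    moreover have "?p \<noteq> 0"
      by (metis coeff_0 coeff_mop_self zero_neq_one)
    ultimately show False
      using poly_roots_finite finite_subset by blast
  qed
qed

lemma DeltaK_1: "DeltaK n \<alpha> \<beta> 1 \<noteq> 0"
  unfolding DeltaK_eq by (subst hankel_det_eq_prod_nrm) (auto simp: nrm_kmom_1)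

text \<open>The determinant of size k + 1 is the product of h_0, ..., h_k, and that formula needs
  only the earlier norms to be nonzero, which is the induction hypothesis.\<close>

lemma nrm_kmom_nonzero:
  assumes "\<And>k. k \<le> Suc n \<Longrightarrow> DeltaK k \<alpha> \<beta> z \<noteq> 0" "k \<le> n"
  shows "nrm (\<lambda>j. kmom \<alpha> \<beta> j z) k \<noteq> 0"
  using assms(2)
proof (induction k rule: less_induct)
  case (less k)
  have "DeltaK (Suc k) \<alpha> \<beta> z = (\<Prod>i<Suc k. nrm (\<lambda>j. kmom \<alpha> \<beta> j z) i)"
    unfolding DeltaK_eq by (rule hankel_det_eq_prod_nrm) (use less in auto)
  then show ?case
    using assms(1)[of "Suc k"] less.prems by auto
qed

section \<open>The sigma equation away from an exceptional set\<close>

lemma SK_holomorphic: "SK n \<alpha> \<beta> holomorphic_on {z. DeltaK n \<alpha> \<beta> z \<noteq> 0}"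
  unfolding SK_def
  by (intro holomorphic_intros holomorphic_on_subset[OF holomorphic_deriv[OF DeltaK_holomorphic open_UNIV]]
      DeltaK_holomorphic) auto

lemma open_DeltaK_nonzero: "open {z. DeltaK n \<alpha> \<beta> z \<noteq> 0}"
  by (intro open_Collect_neq holomorphic_on_imp_continuous_on DeltaK_holomorphic continuous_intros)

text \<open>An entire function whose zeros are the points excluded from the Toda argument: z = 0 or
  a vanishing determinant. Size n + 1 is included since h_n has to be nonzero.\<close>

definition exceptional :: "nat \<Rightarrow> complex \<Rightarrow> complex" where
  "exceptional n z = z * (\<Prod>k\<le>Suc n. DeltaK k \<alpha> \<beta> z)"

lemma exceptional_holomorphic: "exceptional n holomorphic_on A"
  unfolding exceptional_def by (intro holomorphic_intros DeltaK_holomorphic)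

lemma sigma_equation_SK:
  assumes "exceptional n z \<noteq> 0"
  shows "(z * deriv (deriv (SK n \<alpha> \<beta>)) z)\<^sup>2 =
     ((z + of_nat n + of_real \<beta> - 1) * deriv (SK n \<alpha> \<beta>) z - SK n \<alpha> \<beta> z
        - of_nat n * (of_nat n - 1 + 2 * of_real \<alpha>) / 2)\<^sup>2
       - 4 * deriv (SK n \<alpha> \<beta>) z * (deriv (SK n \<alpha> \<beta>) z - of_nat n - of_real \<alpha> + of_real \<beta>)
         * (z * deriv (SK n \<alpha> \<beta>) z - SK n \<alpha> \<beta> z + of_nat n * (of_nat n - 1) / 2)"
proof -
  define D where "D = {z. exceptional n z \<noteq> 0}"
  have nz: "nrm (\<lambda>j. kmom \<alpha> \<beta> j w) k \<noteq> 0" if "w \<in> D" "k \<le> n" for w k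
    by (rule nrm_kmom_nonzero[OF _ that(2)]) (use that(1) in \<open>auto simp: D_def exceptional_def simp del: prod.atMost_Suc\<close>)
  interpret toda "kmom \<alpha> \<beta>" n D
  proof
    show "open D"
      unfolding D_def
      by (intro open_Collect_neq holomorphic_on_imp_continuous_on exceptional_holomorphic continuous_intros)
  qed (auto simp: kmom_holomorphic kmom_flow nz)
  have \<Delta>: "DeltaK n \<alpha> \<beta> w = (\<Prod>k<n. nrm (\<lambda>j. kmom \<alpha> \<beta> j w) k)" if "w \<in> D" for w
    unfolding DeltaK_eq by (rule hankel_det_eq_prod_nrm) (use nz[OF that] in auto)
  have "SK n \<alpha> \<beta> w = rcs (\<lambda>j. kmom \<alpha> \<beta> j w) n" if w: "w \<in> D" for w
  proof -
    have "deriv (DeltaK n \<alpha> \<beta>) w = deriv (\<lambda>w. \<Prod>k<n. nrm (\<lambda>j. kmom \<alpha> \<beta> j w) k) w"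
      by (intro complex_derivative_transform_within_open[OF _ _ D w] DeltaK_holomorphic \<Delta>
          holomorphic_intros holomorphic_nrm) auto
    then have "w * deriv (DeltaK n \<alpha> \<beta>) w = rcs (\<lambda>j. kmom \<alpha> \<beta> j w) n * DeltaK n \<alpha> \<beta> w"
      using deriv_prod_nrm[OF w, of n] \<Delta>[OF w] by simp
    moreover have "DeltaK n \<alpha> \<beta> w \<noteq> 0"
      using w by (auto simp: D_def exceptional_def)
    ultimately show ?thesis
      by (simp add: SK_def)
  qed
  then show ?thesis
    using assms by (intro sigma_equation[of z n]) (auto simp: D_def exceptional_def pearson_kmom)
qed

end

section \<open>Removal of the exceptional points by the identity theorem\<close>

theorem theorem5p4:
  fixes \<alpha> \<beta> :: real and n :: nat and z :: complex
  assumes "\<alpha> > 0" and "\<beta> > 0" and "n \<ge> 1"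
    and "DeltaK n \<alpha> \<beta> z \<noteq> 0"
  shows "(let S = SK n \<alpha> \<beta> z; S' = deriv (SK n \<alpha> \<beta>) z;
              S'' = deriv (deriv (SK n \<alpha> \<beta>)) z;
              a = complex_of_real \<alpha>; b = complex_of_real \<beta>; m = of_nat n
          in (z * S'')\<^sup>2 =
             ((z + m + b - 1) * S' - S - m * (m - 1 + 2 * a) / 2)\<^sup>2
             - 4 * S' * (S' - m - a + b) * (z * S' - S + m * (m - 1) / 2))"
proof -
  interpret kummer_weight \<alpha> \<beta>
    by standard fact+
  define S where "S = SK n \<alpha> \<beta>"
  define U where "U = {z. DeltaK n \<alpha> \<beta> z \<noteq> 0}"
  \<comment> \<open>The defect of the equation, holomorphic wherever the determinant is
    nonzero.\<close>
  define F where "F = (\<lambda>z. (z * deriv (deriv S) z)\<^sup>2 -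
     (((z + of_nat n + of_real \<beta> - 1) * deriv S z - S z - of_nat n * (of_nat n - 1 + 2 * of_real \<alpha>) / 2)\<^sup>2
       - 4 * deriv S z * (deriv S z - of_nat n - of_real \<alpha> + of_real \<beta>)
         * (z * deriv S z - S z + of_nat n * (of_nat n - 1) / 2)))"
  have U: "open U"
    unfolding U_def by (rule open_DeltaK_nonzero)
  have "S holomorphic_on U"
    unfolding S_def U_def by (rule SK_holomorphic)
  then have "F holomorphic_on U"
    unfolding F_def by (intro holomorphic_intros holomorphic_deriv U)
  then have V: "open {w \<in> U. F w \<noteq> 0}"
    using continuous_open_preimage[OF holomorphic_on_imp_continuous_on U, of F "- {0}"]
    by (simp add: vimage_def Int_def open_Compl)
  have bad: "exceptional n w = 0" if "F w \<noteq> 0" for w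
    using sigma_equation_SK[of n w] that unfolding F_def S_def by auto
  have "F z = 0"
  proof (rule ccontr)
    assume "F z \<noteq> 0"
    then have "{w \<in> U. F w \<noteq> 0} \<noteq> {}"
      using assms(4) by (auto simp: U_def)
    \<comment> \<open>The identity theorem is applied to the entire function
      \<open>exceptional n\<close> on the whole plane: it vanishes on the nonempty open subset of
      \<open>U\<close> where \<open>F\<close> is nonzero, hence also at 1.\<close>
    then have "exceptional n 1 = 0"
      using analytic_continuation_open[OF V open_UNIV _ connected_UNIV _ exceptional_holomorphic[of n] holomorphic_on_const[of 0]] bad
      by auto
    then show False
      by (simp add: exceptional_def DeltaK_1)
  qed
  then show ?thesis
    unfolding F_def S_def Let_def by simp
qed

end
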